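(* Let $(\mathfrak g,\cdot,\ast)$ be a compatible pre-Lie algebra over a field $\mathbb K$. Define two brackets on $\mathfrak g$ by $[x,y]=x\cdot y-y\cdot x$ and $\{x,y\}=x\ast y-y\ast x$. Then $(\mathfrak g,[\cdot,\cdot],\{\cdot,\cdot\})$ is a compatible Lie algebra (called the sub-adjacent compatible Lie algebra of $(\mathfrak g,\cdot,\ast)$). Moreover, let $L,\tilde L:\mathfrak g\to\mathfrak{gl}(\mathfrak g)$ be the linear maps $L_xy=x\cdot y$, $\tilde L_xy=x\ast y$. Then $(\mathfrak g,L,\tilde L)$ is a representation of the sub-adjacent compatible Lie algebra $(\mathfrak g,[\cdot,\cdot],\{\cdot,\cdot\})$.
   Context: Pre-Lie algebra: a vector space with a bilinear product $\cdot$ satisfying $(x\cdot y)\cdot z-x\cdot(y\cdot z)=(y\cdot x)\cdot z-y\cdot(x\cdot z)$. Compatible pre-Lie algebra: a triple $(\mathfrak g,\cdot,\ast)$ where $\cdot,\ast$ are pre-Lie products such that for all $x,y,z$: $(x\ast y)\cdot z+(x\cdot y)\ast z-x\cdot(y\ast z)-x\ast(y\cdot z)-(y\ast x)\cdot z-(y\cdot x)\ast z+y\cdot(x\ast z)+y\ast(x\cdot z)=0$. Compatible Lie algebra: $(\mathfrak g,[\cdot,\cdot],\{\cdot,\cdot\})$ with two Lie brackets such that $[\{x,y\},z]+[\{y,z\},x]+[\{z,x\},y]+\{[x,y],z\}+\{[y,z],x\}+\{[z,x],y\}=0$ for all $x,y,z$. Representation of a compatible Lie algebra $(\mathfrak g,[\cdot,\cdot],\{\cdot,\cdot\})$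 on a vector space $W$: a triple $(W,\rho,\mu)$ with $\rho$ a representation of $(\mathfrak g,[\cdot,\cdot])$ on $W$, $\mu$ a representation of $(\mathfrak g,\{\cdot,\cdot\})$ on $W$, and $\rho(\{x,y\})+\mu([x,y])=[\rho(x),\mu(y)]-[\rho(y),\mu(x)]$ (commutators in $\mathfrak{gl}(W)$) for all $x,y$. *)

theory Defs
  imports Complex_Main "HOL-Library.Function_Algebras"
begin

text \<open>As in the library locale \<^locale>\<open>vector_space\<close>, a vector space is a scalar multiplication of
  a field on an abelian group type; dimension and characteristic are arbitrary.\<close>

locale algebra_product = vector_space scale
  for scale :: "'k::field \<Rightarrow> 'g::ab_group_add \<Rightarrow> 'g" +
  fixes prd :: "'g \<Rightarrow> 'g \<Rightarrow> 'g"
  assumes linear_right: "\<And>x. Vector_Spaces.linear scale scale (\<lambda>y. prd x y)"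
    and linear_left: "\<And>y. Vector_Spaces.linear scale scale (\<lambda>x. prd x y)"

locale pre_lie_algebra = algebra_product scale prd
  for scale :: "'k::field \<Rightarrow> 'g::ab_group_add \<Rightarrow> 'g" and prd (infixl \<open>\<cdot>\<close> 70) +
  assumes pre_lie: "(x \<cdot> y) \<cdot> z - x \<cdot> (y \<cdot> z) = (y \<cdot> x) \<cdot> z - y \<cdot> (x \<cdot> z)"

locale compatible_pre_lie_algebra =
  dot: pre_lie_algebra scale dot + ast: pre_lie_algebra scale ast
  for scale :: "'k::field \<Rightarrow> 'g::ab_group_add \<Rightarrow> 'g"
    and dot (infixl \<open>\<cdot>\<close> 70) and ast (infixl \<open>\<star>\<close> 70) +
  assumes compatible:
    "(x \<star> y) \<cdot> z + (x \<cdot> y) \<star> z - x \<cdot> (y \<star> z) - x \<star> (y \<cdot> z)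
     - (y \<star> x) \<cdot> z - (y \<cdot> x) \<star> z + y \<cdot> (x \<star> z) + y \<star> (x \<cdot> z) = 0"

text \<open>The bracket is required to be alternating, which in characteristic 2 is stronger than
  skew-symmetry.\<close>

locale lie_algebra = algebra_product scale br
  for scale :: "'k::field \<Rightarrow> 'g::ab_group_add \<Rightarrow> 'g" and br +
  assumes alternating: "br x x = 0"
    and jacobi: "br (br x y) z + br (br y z) x + br (br z x) y = 0"

locale compatible_lie_algebra =
  br1: lie_algebra scale br1 + br2: lie_algebra scale br2
  for scale :: "'k::field \<Rightarrow> 'g::ab_group_add \<Rightarrow> 'g" and br1 and br2 +
  assumes compatible:
    "br1 (br2 x y) z + br1 (br2 y z) x + br1 (br2 z x) y
     + br2 (br1 x y) z + br2 (br1 y z) x + br2 (br1 z x) y = 0"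

text \<open>The commutator in \<open>gl(W)\<close>; subtraction of maps is pointwise.\<close>

definition gl_bracket :: "('w \<Rightarrow> 'w) \<Rightarrow> ('w \<Rightarrow> 'w) \<Rightarrow> ('w::ab_group_add \<Rightarrow> 'w)" where
  "gl_bracket f g = (f \<circ> g) - (g \<circ> f)"

text \<open>A linear map \<open>\<rho> : g \<rightarrow> gl(W)\<close> is encoded as a linear map into the space of all functions
  \<open>W \<rightarrow> W\<close> with pointwise operations, all of whose values are linear endomorphisms.\<close>

locale lie_algebra_representation =
  lie_algebra scale br + W: vector_space scaleW
  for scale :: "'k::field \<Rightarrow> 'g::ab_group_add \<Rightarrow> 'g" and br
    and scaleW :: "'k \<Rightarrow> 'w::ab_group_add \<Rightarrow> 'w" +
  fixes \<rho> :: "'g \<Rightarrow> 'w \<Rightarrow> 'w"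
  assumes linear_values: "\<And>x. Vector_Spaces.linear scaleW scaleW (\<rho> x)"
    and linear_rep: "Vector_Spaces.linear scale (\<lambda>c f w. scaleW c (f w)) \<rho>"
    and bracket_rep: "\<rho> (br x y) = gl_bracket (\<rho> x) (\<rho> y)"

locale compatible_lie_algebra_representation =
  compatible_lie_algebra scale br1 br2 +
  rep1: lie_algebra_representation scale br1 scaleW \<rho> +
  rep2: lie_algebra_representation scale br2 scaleW \<mu>
  for scale :: "'k::field \<Rightarrow> 'g::ab_group_add \<Rightarrow> 'g" and br1 and br2
    and scaleW :: "'k \<Rightarrow> 'w::ab_group_add \<Rightarrow> 'w" and \<rho> and \<mu> +
  assumes compatible_rep:
    "\<rho> (br2 x y) + \<mu> (br1 x y) = gl_bracket (\<rho> x) (\<mu> y) - gl_bracket (\<rho> y) (\<mu> x)"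

definition commutator_bracket :: "('g \<Rightarrow> 'g \<Rightarrow> 'g) \<Rightarrow> 'g \<Rightarrow> 'g \<Rightarrow> 'g::ab_group_add" where
  "commutator_bracket prd x y = prd x y - prd y x"

definition left_mult :: "('g \<Rightarrow> 'g \<Rightarrow> 'g) \<Rightarrow> 'g \<Rightarrow> 'g \<Rightarrow> 'g" where
  "left_mult prd x = (\<lambda>y. prd x y)"

end

theory Submission
  imports Defs
begin

text \<open>Write \<open>L\<close> and \<open>M\<close> for left multiplication by the two products.
  The pre-Lie identity, solved for the product by a bracket, says
  \<open>L [x,y] = [L x, L y]\<close>, and likewise for \<open>M\<close>. The compatibility
  condition says in the same way \<open>L {x,y} + M [x,y] = [L x, M y] - [L y, M x]\<close>. These
  are already the conditions on a representation (\<open>commutator_bracket_prd\<close>,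
  \<open>mixed_commutator_bracket\<close>). They also turn every iterated bracket into products
  nested on the right only, and in a cyclic sum these cancel in pairs; this gives both Jacobi
  identities and the mixed one.\<close>

text \<open>Linearity of \<open>left_mult\<close> requires its target, the space of all functions,
  to be a vector space.\<close>

lemma vector_space_pointwise:
  assumes "vector_space (scale :: 'k::field \<Rightarrow> 'w::ab_group_add \<Rightarrow> 'w)"
  shows "vector_space (\<lambda>c (f :: 'a \<Rightarrow> 'w) x. scale c (f x))"
proof -
  interpret vector_space scale by fact
  show ?thesis
    by unfold_locales (auto simp: fun_eq_iff algebra_simps)
qed

context algebra_product
begin

lemma prd_simps:
  "prd (x + y) z = prd x z + prd y z" "prd (x - y) z = prd x z - prd y z"
  "prd x (y + z) = prd x y + prd x z" "prd x (y - z) = prd x y - prd x z"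
  "prd (scale c x) y = scale c (prd x y)" "prd x (scale c y) = scale c (prd x y)"
  using module_hom.add[OF Vector_Spaces.linear.axioms(3)[OF linear_left[of z]], of x y]
    module_hom.diff[OF Vector_Spaces.linear.axioms(3)[OF linear_left[of z]], of x y]
    module_hom.add[OF Vector_Spaces.linear.axioms(3)[OF linear_right[of x]], of y z]
    module_hom.diff[OF Vector_Spaces.linear.axioms(3)[OF linear_right[of x]], of y z]
    module_hom.scale[OF Vector_Spaces.linear.axioms(3)[OF linear_left[of y]], of c x]
    module_hom.scale[OF Vector_Spaces.linear.axioms(3)[OF linear_right[of x]], of c y]
  by simp_all

lemma algebra_product_commutator_bracket: "algebra_product scale (commutator_bracket prd)"
proof -
  have "vector_space scale" ..
  then show ?thesis
    by (auto intro!: algebra_product.intro algebra_product_axioms.intro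
        simp: Vector_Spaces.linear_iff commutator_bracket_def prd_simps algebra_simps)
qed

lemma linear_left_mult:
  "Vector_Spaces.linear scale (\<lambda>c f w. scale c (f w)) (left_mult prd)"
proof -
  have "vector_space scale" ..
  then show ?thesis
    by (simp add: Vector_Spaces.linear_iff vector_space_pointwise left_mult_def prd_simps fun_eq_iff)
qed

end

context pre_lie_algebra
begin

text \<open>The pre-Lie identity rearranged: left multiplication sends brackets to commutators of
  operators.\<close>

lemma commutator_bracket_prd: "commutator_bracket (\<cdot>) x y \<cdot> z = x \<cdot> (y \<cdot> z) - y \<cdot> (x \<cdot> z)"
  using pre_lie[of x y z] by (simp add: commutator_bracket_def prd_simps algebra_simps)

lemma lie_algebra_commutator_bracket: "lie_algebra scale (commutator_bracket (\<cdot>))"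
proof (intro lie_algebra.intro lie_algebra_axioms.intro algebra_product_commutator_bracket)
  let ?b = "commutator_bracket (\<cdot>)"
  show "?b x x = 0" for x
    by (simp add: commutator_bracket_def)
  \<comment> \<open>Only the outer bracket is unfolded at first, so that the inner one is still
    there for \<open>commutator_bracket_prd\<close>.\<close>
  have "?b (?b x y) z = x \<cdot> (y \<cdot> z) - y \<cdot> (x \<cdot> z) - z \<cdot> (x \<cdot> y) + z \<cdot> (y \<cdot> x)" for x y z
    unfolding commutator_bracket_def[of _ "?b x y"] commutator_bracket_prd
    by (simp add: commutator_bracket_def prd_simps)
  then show "?b (?b x y) z + ?b (?b y z) x + ?b (?b z x) y = 0" for x y z
    by simp
qed

lemma lie_algebra_representation_left_mult:
  "lie_algebra_representation scale (commutator_bracket (\<cdot>)) scale (left_mult (\<cdot>))"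
  by (intro lie_algebra_representation.intro lie_algebra_representation_axioms.intro
      lie_algebra_commutator_bracket linear_left_mult vector_space_axioms)
    (auto simp: left_mult_def linear_right gl_bracket_def commutator_bracket_prd)

end

context compatible_pre_lie_algebra
begin

text \<open>The mixed analogue of \<open>commutator_bracket_prd\<close>: compatibility controls only
  the sum of the two terms on the left, not each one.\<close>

lemma mixed_commutator_bracket:
  "commutator_bracket (\<star>) x y \<cdot> z + commutator_bracket (\<cdot>) x y \<star> z
    = x \<cdot> (y \<star> z) + x \<star> (y \<cdot> z) - y \<cdot> (x \<star> z) - y \<star> (x \<cdot> z)"
  using compatible[of x y z]
  by (simp add: commutator_bracket_def dot.prd_simps ast.prd_simps algebra_simps)

lemma compatible_lie_algebra_commutator_bracket:
  "compatible_lie_algebra scale (commutator_bracket (\<cdot>)) (commutator_bracket (\<star>))"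
proof (intro compatible_lie_algebra.intro compatible_lie_algebra_axioms.intro
    dot.lie_algebra_commutator_bracket ast.lie_algebra_commutator_bracket)
  fix x y z
  let ?b = "commutator_bracket (\<cdot>)" and ?c = "commutator_bracket (\<star>)"
  \<comment> \<open>The two mixed double brackets are therefore expanded together.\<close>
  have *: "?b (?c x y) z + ?c (?b x y) z
      = x \<cdot> (y \<star> z) + x \<star> (y \<cdot> z) - y \<cdot> (x \<star> z) - y \<star> (x \<cdot> z)
        - z \<cdot> (x \<star> y) + z \<cdot> (y \<star> x) - z \<star> (x \<cdot> y) + z \<star> (y \<cdot> x)" for x y z
  proof -
    have "?b (?c x y) z + ?c (?b x y) z
        = (?c x y \<cdot> z + ?b x y \<star> z) - z \<cdot> ?c x y - z \<star> ?b x y"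
      by (simp add: commutator_bracket_def[of _ "?c x y"] commutator_bracket_def[of _ "?b x y"])
    then show ?thesis
      unfolding mixed_commutator_bracket
      by (simp add: commutator_bracket_def dot.prd_simps ast.prd_simps)
  qed
  \<comment> \<open>Regrouping by cyclic position makes \<open>*\<close> applicable; each nested
    product then occurs twice, with opposite signs.\<close>
  have "?b (?c x y) z + ?b (?c y z) x + ?b (?c z x) y
      + ?c (?b x y) z + ?c (?b y z) x + ?c (?b z x) y
    = (?b (?c x y) z + ?c (?b x y) z) + (?b (?c y z) x + ?c (?b y z) x)
      + (?b (?c z x) y + ?c (?b z x) y)"
    by (simp only: ac_simps)
  also have "\<dots> = 0"
    unfolding * by simp
  finally show "?b (?c x y) z + ?b (?c y z) x + ?b (?c z x) y
      + ?c (?b x y) z + ?c (?b y z) x + ?c (?b z x) y = 0" .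
qed

text \<open>The remaining mixed condition is \<open>mixed_commutator_bracket\<close> evaluated at a
  vector.\<close>

lemma compatible_lie_algebra_representation_left_mult:
  "compatible_lie_algebra_representation scale (commutator_bracket (\<cdot>)) (commutator_bracket (\<star>))
    scale (left_mult (\<cdot>)) (left_mult (\<star>))"
  by (intro compatible_lie_algebra_representation.intro
      compatible_lie_algebra_representation_axioms.intro
      compatible_lie_algebra_commutator_bracket
      dot.lie_algebra_representation_left_mult ast.lie_algebra_representation_left_mult)
    (simp add: fun_eq_iff left_mult_def gl_bracket_def mixed_commutator_bracket)

end

theorem proposition2p10:
  fixes scale :: "'k::field \<Rightarrow> 'g::ab_group_add \<Rightarrow> 'g"
    and dot ast :: "'g \<Rightarrow> 'g \<Rightarrow> 'g"
  assumes "compatible_pre_lie_algebra scale dot ast"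
  shows "compatible_lie_algebra scale (commutator_bracket dot) (commutator_bracket ast)
    \<and> compatible_lie_algebra_representation scale
        (commutator_bracket dot) (commutator_bracket ast)
        scale (left_mult dot) (left_mult ast)"
  using compatible_pre_lie_algebra.compatible_lie_algebra_commutator_bracket[OF assms]
    compatible_pre_lie_algebra.compatible_lie_algebra_representation_left_mult[OF assms]
  by blast

end
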